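(* Let $G$ be a graph. A set $X\subseteq V(G)$ is a $\frac{1}{2}$-dominating set if and only if $X$ is a global $(\mathbb{Z},\{o\in\mathbb{Z} : o\geq 0\})$-alliance.
   Context: Graphs are finite and simple. For a graph $G=(V,E)$, $S\subseteq V$ and $v\in V$, $N_S(v)$ is the set of neighbors of $v$ lying in $S$, $\delta_S(v)=|N_S(v)|$, $\overline{S}=V\setminus S$, $N(v)=N_V(v)$ is the open neighborhood, $N(S)=\bigcup_{u\in S}N(u)$ and $N[S]=N(S)\cup S$. A set $S$ is dominating if $N[S]=V$. For $D,O\subseteq\mathbb{Z}$, a $(D,O)$-alliance in $G$ is a vertex set $S$ such that (1) $\delta_S(v)-\delta_{\overline{S}}(v)\in D$ for all $v\in S$, and (2) $\delta_S(v)-\delta_{\overline{S}}(v)\in O$ for all $v\in N(S)\setminus S$. It is called global if $S$ is also a dominating set. For $0<\alpha\le 1$, an $\alpha$-dominating set in $G$ is a vertex set $X$ such that $|N(v)\cap X|\geq \alpha|N(v)|$ for all $v\notin X$.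
   Formalization: The formal theorem additionally assumes that X contains every isolated vertex of G; without this the equivalence fails, e.g. for a single vertex and X empty, which is 1/2-dominating but not dominating. *)

theory Defs
  imports Complex_Main "Graph_Theory.Pair_Digraph"
begin

text \<open>Finite simple graphs are the records \<open>G\<close> satisfying \<open>pair_graph G\<close>: finite vertex set,
  and an arc relation that is symmetric and loop-free, every edge \<open>uv\<close> being the two arcs
  \<open>(u, v)\<close> and \<open>(v, u)\<close>.\<close>

definition nbrs :: "'a pair_pre_digraph \<Rightarrow> 'a \<Rightarrow> 'a set" where
  "nbrs G v = {u \<in> pverts G. (v, u) \<in> parcs G}"

definition nbrs_in :: "'a pair_pre_digraph \<Rightarrow> 'a set \<Rightarrow> 'a \<Rightarrow> 'a set" where
  "nbrs_in G S v = {u \<in> S. u \<in> nbrs G v}"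

definition deg_in :: "'a pair_pre_digraph \<Rightarrow> 'a set \<Rightarrow> 'a \<Rightarrow> nat" where
  "deg_in G S v = card (nbrs_in G S v)"

definition nbrs_set :: "'a pair_pre_digraph \<Rightarrow> 'a set \<Rightarrow> 'a set" where
  "nbrs_set G S = (\<Union>u\<in>S. nbrs G u)"

definition closed_nbrs_set :: "'a pair_pre_digraph \<Rightarrow> 'a set \<Rightarrow> 'a set" where
  "closed_nbrs_set G S = nbrs_set G S \<union> S"

definition dominating_set :: "'a pair_pre_digraph \<Rightarrow> 'a set \<Rightarrow> bool" where
  "dominating_set G S \<longleftrightarrow> S \<subseteq> pverts G \<and> closed_nbrs_set G S = pverts G"

definition alliance :: "int set \<Rightarrow> int set \<Rightarrow> 'a pair_pre_digraph \<Rightarrow> 'a set \<Rightarrow> bool" where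
  "alliance D U G S \<longleftrightarrow>
     S \<subseteq> pverts G \<and>
     (\<forall>v\<in>S. int (deg_in G S v) - int (deg_in G (pverts G - S) v) \<in> D) \<and>
     (\<forall>v\<in>nbrs_set G S - S. int (deg_in G S v) - int (deg_in G (pverts G - S) v) \<in> U)"

definition global_alliance :: "int set \<Rightarrow> int set \<Rightarrow> 'a pair_pre_digraph \<Rightarrow> 'a set \<Rightarrow> bool" where
  "global_alliance D U G S \<longleftrightarrow> alliance D U G S \<and> dominating_set G S"

text \<open>An isolated vertex outside \<open>X\<close> satisfies the inequality below trivially (\<open>0 \<ge> \<alpha> * 0\<close>), so
  an \<open>\<alpha>\<close>-dominating set is a dominating set only if it contains all isolated vertices of \<open>G\<close>
  (in particular whenever \<open>G\<close> has none).\<close>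

definition alpha_dominating_set :: "real \<Rightarrow> 'a pair_pre_digraph \<Rightarrow> 'a set \<Rightarrow> bool" where
  "alpha_dominating_set \<alpha> G X \<longleftrightarrow>
     0 < \<alpha> \<and> \<alpha> \<le> 1 \<and> X \<subseteq> pverts G \<and>
     (\<forall>v\<in>pverts G - X. real (card (nbrs G v \<inter> X)) \<ge> \<alpha> * real (card (nbrs G v)))"

end

theory Submission
  imports Defs
begin

text \<open>For \<open>X \<subseteq> V(G)\<close> the neighborhood of \<open>v\<close> splits into its parts inside and outside \<open>X\<close>, so
  \<open>|N(v) \<inter> X| \<ge> |N(v)| / 2\<close> says exactly that \<open>v\<close> has at least as many neighbors in \<open>X\<close> as
  outside it (lemma \<open>half_nbrs_iff_deg_diff_nonneg\<close>). Hence the two notions impose the same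
  inequality, one on all vertices outside \<open>X\<close>, the other only on those lying in \<open>N(X)\<close>. A
  dominating set leaves no vertex outside \<open>N(X) \<union> X\<close>, so the two ranges agree for a global
  alliance. Conversely, let \<open>X\<close> be \<open>1/2\<close>-dominating. A vertex outside \<open>X\<close> is not
  isolated, since \<open>X\<close> contains all isolated vertices, so by the inequality it has a neighbor in
  \<open>X\<close>: the set is dominating (lemma \<open>alpha_dominating_imp_dominating\<close>).\<close>

lemma card_nbrs_eq_deg_in_sum:
  assumes "finite (pverts G)" and "X \<subseteq> pverts G"
  shows "card (nbrs G v) = deg_in G X v + deg_in G (pverts G - X) v"
proof -
  have "nbrs G v = nbrs_in G X v \<union> nbrs_in G (pverts G - X) v"
    using assms(2) by (auto simp: nbrs_def nbrs_in_def)
  moreover have "finite (nbrs_in G X v)" "finite (nbrs_in G (pverts G - X) v)"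
    using assms by (auto simp: nbrs_in_def intro: finite_subset)
  moreover have "nbrs_in G X v \<inter> nbrs_in G (pverts G - X) v = {}"
    by (auto simp: nbrs_in_def)
  ultimately show ?thesis
    unfolding deg_in_def by (simp add: card_Un_disjoint)
qed

lemma half_nbrs_iff_deg_diff_nonneg:
  assumes "finite (pverts G)" and "X \<subseteq> pverts G"
  shows "real (card (nbrs G v \<inter> X)) \<ge> (1/2) * real (card (nbrs G v)) \<longleftrightarrow>
    int (deg_in G X v) - int (deg_in G (pverts G - X) v) \<ge> 0"
proof -
  have "nbrs G v \<inter> X = nbrs_in G X v"
    by (auto simp: nbrs_in_def)
  then have "card (nbrs G v \<inter> X) = deg_in G X v"
    by (simp add: deg_in_def)
  then show ?thesis
    using card_nbrs_eq_deg_in_sum[OF assms, of v] by auto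
qed

lemma nbrs_sym:
  assumes "pair_graph G" and "v \<in> pverts G" and "u \<in> nbrs G v"
  shows "v \<in> nbrs G u"
proof -
  interpret pair_graph G by fact
  show ?thesis
    using assms(2,3) arcs_symmetric by (auto simp: nbrs_def)
qed

lemma nbrs_set_subset: "nbrs_set G X \<subseteq> pverts G"
  by (auto simp: nbrs_set_def nbrs_def)

lemma alpha_dominating_imp_dominating:
  assumes "pair_graph G"
    and dom: "alpha_dominating_set \<alpha> G X"
    and isolated: "\<And>v. v \<in> pverts G \<Longrightarrow> nbrs G v = {} \<Longrightarrow> v \<in> X"
  shows "dominating_set G X"
proof -
  interpret pair_graph G by fact
  have "v \<in> nbrs_set G X" if v: "v \<in> pverts G" "v \<notin> X" for v
  proof -
    have "finite (nbrs G v)"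
      by (simp add: nbrs_def)
    then have "card (nbrs G v) > 0"
      using isolated v by (auto simp: card_gt_0_iff)
    then have "0 < \<alpha> * real (card (nbrs G v))"
      using dom by (simp add: alpha_dominating_set_def)
    also have "\<dots> \<le> real (card (nbrs G v \<inter> X))"
      using dom v by (simp add: alpha_dominating_set_def)
    finally obtain u where "u \<in> nbrs G v" "u \<in> X"
      by (auto simp: card_gt_0_iff)
    then show ?thesis
      using nbrs_sym[OF assms(1) v(1)] by (auto simp: nbrs_set_def)
  qed
  then show ?thesis
    using dom nbrs_set_subset[of G X]
    by (auto simp: dominating_set_def closed_nbrs_set_def alpha_dominating_set_def)
qed

theorem proposition9:
  fixes G :: "'a pair_pre_digraph" and X :: "'a set"
  assumes "pair_graph G"
    and "X \<subseteq> pverts G"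
    and isolated: "\<And>v. v \<in> pverts G \<Longrightarrow> nbrs G v = {} \<Longrightarrow> v \<in> X"
  shows "alpha_dominating_set (1/2) G X \<longleftrightarrow> global_alliance UNIV {i. i \<ge> 0} G X"
proof -
  interpret pair_graph G by fact
  note half_iff = half_nbrs_iff_deg_diff_nonneg[OF finite_verts assms(2)]
  show ?thesis
  proof
    assume dom: "alpha_dominating_set (1/2) G X"
    then have "\<forall>v\<in>pverts G - X. int (deg_in G X v) - int (deg_in G (pverts G - X) v) \<ge> 0"
      unfolding alpha_dominating_set_def half_iff by blast
    then have "alliance UNIV {i. i \<ge> 0} G X"
      using assms(2) nbrs_set_subset[of G X] unfolding alliance_def by blast
    then show "global_alliance UNIV {i. i \<ge> 0} G X"
      using alpha_dominating_imp_dominating[OF assms(1) dom isolated]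
      by (simp add: global_alliance_def)
  next
    assume glob: "global_alliance UNIV {i. i \<ge> 0} G X"
    then have "pverts G - X = nbrs_set G X - X"
      by (auto simp: global_alliance_def dominating_set_def closed_nbrs_set_def)
    then have "\<forall>v\<in>pverts G - X. int (deg_in G X v) - int (deg_in G (pverts G - X) v) \<ge> 0"
      using glob unfolding global_alliance_def alliance_def by blast
    then show "alpha_dominating_set (1/2) G X"
      using assms(2) unfolding alpha_dominating_set_def half_iff by simp
  qed
qed

end
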